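(* Let $d\ge 2$. Let $(A_i)_{i\in I}\subset\mathcal{S}_{rc}^d$ be a net and $A\in\mathcal{S}_{rc}^d$. Then $(A_i)_{i\in I}$ converges to $A$ in the radial Wijsman topology $\tau_{W^r}$ if and only if the net of radial functions $(\rho_{A_i})_{i\in I}$ converges pointwise on $\mathbb{S}^{d-1}$ to $\rho_A$ (as functions with values in $[0,\infty]$). The same holds with $\mathcal{S}_1^d$ in place of $\mathcal{S}_{rc}^d$ (i.e. for nets in $\mathcal{S}_1^d$, limits in $\mathcal{S}_1^d$, and the radial Wijsman topology on $\mathcal{S}_1^d$).
   Context: $B_2^d$ and $\mathbb{S}^{d-1}$ are the closed Euclidean unit ball and the unit sphere of $\mathbb{R}^d$. A star set is a non-empty $A\subseteq\mathbb{R}^d$ with $ta\in A$ for all $a\in A$, $0\le t\le 1$. Its radial function is $\rho_A:\mathbb{S}^{d-1}\to[0,\infty]$, $\rho_A(\theta)=\sup\{\lambda\ge 0:\lambda\theta\in A\}$. A star body is a star set $A$ that is radially closed: $\rho_A(\theta)\theta\in A$ whenever $\rho_A(\theta)<\infty$ (it may be unbounded or non-closed; it is determined by $\rho_A$). $\mathcal{S}_{rc}^d$ is the family of all star bodies in $\mathbb{R}^d$, and $\mathcal{S}_1^d$ the subfamily of those with $\rho_A:\mathbb{S}^{d-1}\to[0,\infty]$ continuous. The radial sum $A_1\tilde{+}A_2$ of star bodies is the star body with radial function $\rho_{A_1}+\rho_{A_2}$. The radial distance from $x\in\mathbb{R}^d$ to $A\in\mathcal{S}_{rc}^d$ is $d_r(x,A)=\inf\{\alpha>0: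 x\in A\tilde{+}\alpha B_2^d\}\in[0,\infty)$. The radial Wijsman topology $\tau_{W^r}$ on $\mathcal{S}_{rc}^d$ (resp. on $\mathcal{S}_1^d$) is the weakest topology making all maps $A\mapsto d_r(x,A)$, $x\in\mathbb{R}^d$, continuous on $\mathcal{S}_{rc}^d$ (resp. on $\mathcal{S}_1^d$). *)

theory Defs
  imports "HOL-Analysis.Analysis"
begin

definition directed_set :: "'i set \<Rightarrow> ('i \<Rightarrow> 'i \<Rightarrow> bool) \<Rightarrow> bool" where
  "directed_set I le \<longleftrightarrow> I \<noteq> {} \<and> (\<forall>i\<in>I. le i i) \<and>
     (\<forall>i\<in>I. \<forall>j\<in>I. \<forall>k\<in>I. le i j \<longrightarrow> le j k \<longrightarrow> le i k) \<and>
     (\<forall>i\<in>I. \<forall>j\<in>I. \<exists>k\<in>I. le i k \<and> le j k)"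

text \<open>The filter of tails: convergence of a net indexed by a directed set \<open>I\<close> is convergence
  along this filter (see \<open>eventually_net_filter\<close>).\<close>

definition net_filter :: "'i set \<Rightarrow> ('i \<Rightarrow> 'i \<Rightarrow> bool) \<Rightarrow> 'i filter" where
  "net_filter I le = (INF i\<in>I. principal {j\<in>I. le i j})"

lemma eventually_net_filter:
  assumes "directed_set I le"
  shows "eventually P (net_filter I le) \<longleftrightarrow> (\<exists>i\<in>I. \<forall>j\<in>I. le i j \<longrightarrow> P j)"
proof -
  have "\<exists>k\<in>I. principal {l\<in>I. le k l} \<le> inf (principal {l\<in>I. le i l}) (principal {l\<in>I. le j l})"
    if ij: "i \<in> I" "j \<in> I" for i j
  proof -
    obtain k where "k \<in> I" "le i k" "le j k"
      using assms ij unfolding directed_set_def by meson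
    moreover have "{l\<in>I. le k l} \<subseteq> {l\<in>I. le i l} \<inter> {l\<in>I. le j l}"
      using assms ij calculation unfolding directed_set_def by blast
    ultimately show ?thesis by (intro bexI[of _ k]) auto
  qed
  moreover have "I \<noteq> {}"
    using assms unfolding directed_set_def by blast
  ultimately have "eventually P (net_filter I le) \<longleftrightarrow>
      (\<exists>i\<in>I. eventually P (principal {j\<in>I. le i j}))"
    unfolding net_filter_def
    by (intro eventually_INF_base)
  then show ?thesis unfolding eventually_principal by blast
qed

definition star_set :: "'a::euclidean_space set \<Rightarrow> bool" where
  "star_set A \<longleftrightarrow> A \<noteq> {} \<and> (\<forall>a\<in>A. \<forall>t\<in>{0..1}. t *\<^sub>R a \<in> A)"

text \<open>Only the values on the unit sphere are meaningful.\<close>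

definition radial_function :: "'a::euclidean_space set \<Rightarrow> 'a \<Rightarrow> ennreal" where
  "radial_function A \<theta> = (SUP l\<in>{l. 0 \<le> l \<and> l *\<^sub>R \<theta> \<in> A}. ennreal l)"

definition star_body :: "'a::euclidean_space set \<Rightarrow> bool" where
  "star_body A \<longleftrightarrow> star_set A \<and>
     (\<forall>\<theta>\<in>sphere 0 1. radial_function A \<theta> < \<infinity> \<longrightarrow>
        enn2real (radial_function A \<theta>) *\<^sub>R \<theta> \<in> A)"

definition star_bodies :: "'a::euclidean_space set set" where
  "star_bodies = {A. star_body A}"

definition continuous_star_bodies :: "'a::euclidean_space set set" where
  "continuous_star_bodies =
     {A. star_body A \<and> continuous_on (sphere 0 1) (radial_function A)}"

text \<open>A definite description, proper by \<open>star_body_radial_ex1\<close> below.\<close>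

definition radial_sum :: "'a::euclidean_space set \<Rightarrow> 'a set \<Rightarrow> 'a set" where
  "radial_sum A B = (THE C. star_body C \<and>
     (\<forall>\<theta>\<in>sphere 0 1. radial_function C \<theta> = radial_function A \<theta> + radial_function B \<theta>))"

lemma mem_star_body_iff:
  fixes A :: "'a::euclidean_space set"
  assumes A: "star_body A" and \<theta>: "norm \<theta> = 1" and r: "r \<ge> 0"
  shows "r *\<^sub>R \<theta> \<in> A \<longleftrightarrow> ennreal r \<le> radial_function A \<theta>"
proof
  assume "r *\<^sub>R \<theta> \<in> A"
  then show "ennreal r \<le> radial_function A \<theta>"
    unfolding radial_function_def using r by (intro SUP_upper) auto
next
  have star: "u *\<^sub>R \<theta> \<in> A" if "s *\<^sub>R \<theta> \<in> A" "0 \<le> u" "u \<le> s" for s u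
  proof (cases "s = 0")
    case True
    then show ?thesis using that by simp
  next
    case False
    then have "u / s \<in> {0..1}" using that by (auto simp: divide_simps)
    then have "(u / s) *\<^sub>R (s *\<^sub>R \<theta>) \<in> A"
      using A that(1) unfolding star_body_def star_set_def by blast
    then show ?thesis using False by simp
  qed
  assume le: "ennreal r \<le> radial_function A \<theta>"
  show "r *\<^sub>R \<theta> \<in> A"
  proof (cases "radial_function A \<theta> < \<infinity>")
    case True
    then have "enn2real (radial_function A \<theta>) *\<^sub>R \<theta> \<in> A"
      using A \<theta> unfolding star_body_def by auto
    moreover have "r \<le> enn2real (radial_function A \<theta>)"
      using enn2real_mono[OF le] r True by simp
    ultimately show ?thesis using star r by blast
  next
    case False
    then have "ennreal r < radial_function A \<theta>"
      by (simp add: not_less top_unique)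
    then obtain l where "0 \<le> l" "l *\<^sub>R \<theta> \<in> A" "ennreal r < ennreal l"
      unfolding radial_function_def less_SUP_iff by auto
    then show ?thesis using star[of l r] r by (simp add: ennreal_less_iff)
  qed
qed

lemma star_body_radial_ex1:
  fixes f :: "'a::euclidean_space \<Rightarrow> ennreal"
  shows "\<exists>!C. star_body C \<and> (\<forall>\<theta>\<in>sphere 0 1. radial_function C \<theta> = f \<theta>)"
proof (rule ex_ex1I)
  define C where "C = {x. x = 0 \<or> ennreal (norm x) \<le> f (x /\<^sub>R norm x)}"
  have C_mem: "r *\<^sub>R \<theta> \<in> C \<longleftrightarrow> ennreal r \<le> f \<theta>" if "norm \<theta> = 1" "0 \<le> r" for r \<theta>
    using that by (cases "r = 0") (auto simp: C_def)
  have rad: "radial_function C \<theta> = f \<theta>" if "norm \<theta> = 1" for \<theta>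
  proof (rule antisym)
    show "radial_function C \<theta> \<le> f \<theta>"
      unfolding radial_function_def using C_mem[OF that] by (auto intro!: SUP_least)
    show "f \<theta> \<le> radial_function C \<theta>"
    proof (rule dense_le)
      fix y assume y: "y < f \<theta>"
      then have "y < \<infinity>" using order_less_le_trans by fastforce
      then obtain r where r: "0 \<le> r" "y = ennreal r" by (cases y) auto
      then show "y \<le> radial_function C \<theta>"
        unfolding radial_function_def r(2) using C_mem[OF that r(1)] r y
        by (intro SUP_upper) simp
    qed
  qed
  have "star_set C"
    unfolding star_set_def
  proof (intro conjI ballI)
    show "C \<noteq> {}" by (auto simp: C_def)
    fix a and t :: real assume a: "a \<in> C" and t: "t \<in> {0..1}"
    show "t *\<^sub>R a \<in> C"
    proof (cases "t = 0 \<or> a = 0")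
      case True
      then show ?thesis by (auto simp: C_def)
    next
      case False
      have "ennreal (t * norm a) \<le> ennreal (norm a)"
        using t by (intro ennreal_leI) (simp add: mult_left_le_one_le)
      moreover have "(t *\<^sub>R a) /\<^sub>R norm (t *\<^sub>R a) = a /\<^sub>R norm a"
        using False t by simp
      moreover have "ennreal (norm a) \<le> f (a /\<^sub>R norm a)"
        using False a by (simp add: C_def)
      ultimately have "ennreal (norm (t *\<^sub>R a)) \<le> f ((t *\<^sub>R a) /\<^sub>R norm (t *\<^sub>R a))"
        using t by (metis abs_of_nonneg atLeastAtMost_iff norm_scaleR order_trans)
      then show ?thesis unfolding C_def by blast
    qed
  qed
  moreover have "enn2real (radial_function C \<theta>) *\<^sub>R \<theta> \<in> C"
    if "\<theta> \<in> sphere 0 1" "radial_function C \<theta> < \<infinity>" for \<theta>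
    using that rad[of \<theta>] C_mem[of \<theta>] by simp
  ultimately have "star_body C" unfolding star_body_def by blast
  with rad show "\<exists>C. star_body C \<and> (\<forall>\<theta>\<in>sphere 0 1. radial_function C \<theta> = f \<theta>)"
    by auto
next
  fix C D :: "'a set"
  assume CD: "star_body C \<and> (\<forall>\<theta>\<in>sphere 0 1. radial_function C \<theta> = f \<theta>)"
    "star_body D \<and> (\<forall>\<theta>\<in>sphere 0 1. radial_function D \<theta> = f \<theta>)"
  show "C = D"
  proof (rule set_eqI)
    fix x :: 'a
    obtain \<theta> where \<theta>: "norm \<theta> = 1" "x = norm x *\<^sub>R \<theta>"
    proof (cases "x = 0")
      case True
      obtain b :: 'a where "b \<in> Basis" by (meson nonempty_Basis ex_in_conv)
      then show ?thesis using that[of b] True by simp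
    next
      case False
      then show ?thesis using that[of "x /\<^sub>R norm x"] by simp
    qed
    show "x \<in> C \<longleftrightarrow> x \<in> D"
      using mem_star_body_iff[of C \<theta> "norm x"] mem_star_body_iff[of D \<theta> "norm x"] CD \<theta>
      by (metis dist_0_norm mem_sphere norm_ge_zero)
  qed
qed

text \<open>The infimum is over a non-empty set of reals bounded below, since every
  \<open>\<alpha> \<ge> norm x\<close> with \<open>\<alpha> > 0\<close> belongs to it when \<open>A\<close> is a star body.\<close>

definition radial_dist :: "'a::euclidean_space \<Rightarrow> 'a set \<Rightarrow> real" where
  "radial_dist x A =
     Inf {\<alpha>. 0 < \<alpha> \<and> x \<in> radial_sum A ((\<lambda>y. \<alpha> *\<^sub>R y) ` cball 0 1)}"

text \<open>The sub-basic set for \<open>U = UNIV\<close> is \<open>S\<close> itself, so the carrier is \<open>S\<close>; minimality is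
  \<open>radial_wijsman_weakest\<close> below.\<close>

definition radial_wijsman :: "'a::euclidean_space set set \<Rightarrow> 'a set topology" where
  "radial_wijsman S =
     topology_generated_by {{A \<in> S. radial_dist x A \<in> U} |x U. open U}"

lemma topspace_radial_wijsman [simp]: "topspace (radial_wijsman S) = S"
proof -
  have "S \<in> {{A \<in> S. radial_dist x A \<in> U} |x U. open U}"
    by (rule CollectI, rule exI, rule exI[of _ UNIV]) simp
  moreover have "\<Union>{{A \<in> S. radial_dist x A \<in> U} |x U. open U} \<subseteq> S" by blast
  ultimately show ?thesis
    unfolding radial_wijsman_def topology_generated_by_topspace by blast
qed

lemma continuous_map_radial_dist:
  "continuous_map (radial_wijsman S) euclideanreal (radial_dist x)"
proof -
  have "openin (radial_wijsman S) {A \<in> S. radial_dist x A \<in> U}" if "open U" for U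
    unfolding radial_wijsman_def using that by (intro topology_generated_by_Basis) blast
  then show ?thesis by (simp add: continuous_map_def)
qed

lemma radial_wijsman_weakest:
  assumes "topspace T = S" and "\<And>x. continuous_map T euclideanreal (radial_dist x)"
    and "openin (radial_wijsman S) V"
  shows "openin T V"
proof -
  have "openin T W" if "W \<in> {{A \<in> S. radial_dist x A \<in> U} |x U. open U}" for W
    using that assms(1,2) by (auto simp: continuous_map_def)
  moreover have "generate_topology_on {{A \<in> S. radial_dist x A \<in> U} |x U. open U} V"
    using assms(3) unfolding radial_wijsman_def openin_topology_generated_by_iff .
  ultimately show ?thesis
    by (rule generate_topology_on_coarsest[OF istopology_openin])
qed

end

theory Submission
  imports Defs
begin

text \<open>For a unit vector \<open>\<theta>\<close> and \<open>r \<ge> 0\<close> the radial distance is the truncated difference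
  \<open>d\<^sub>r(r\<theta>, A) = (r - \<rho>\<^sub>A(\<theta>))\<^sup>+\<close>. Wijsman convergence therefore means
  \<open>(r - \<rho>\<^sub>i(\<theta>))\<^sup>+ \<longlongrightarrow> (r - \<rho>\<^sub>A(\<theta>))\<^sup>+\<close> for all \<open>\<theta>\<close> and all \<open>r \<ge> 0\<close>. For fixed \<open>\<theta>\<close> this is
  equivalent to \<open>\<rho>\<^sub>i(\<theta>) \<longlongrightarrow> \<rho>\<^sub>A(\<theta>)\<close> in \<open>[0,\<infinity>]\<close>, because a real \<open>r\<close>
  fits strictly between any two distinct values in \<open>[0,\<infinity>]\<close>, and the truncated difference at
  that \<open>r\<close> then bounds \<open>\<rho>\<^sub>i(\<theta>)\<close> on the required side.\<close>

lemma radial_function_cball: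
  fixes \<theta> :: "'a::euclidean_space"
  assumes "norm \<theta> = 1" "0 < \<alpha>"
  shows "radial_function ((\<lambda>y. \<alpha> *\<^sub>R y) ` cball 0 1) \<theta> = ennreal \<alpha>"
proof -
  have "(\<lambda>y. \<alpha> *\<^sub>R y) ` cball 0 1 = cball (0::'a) \<alpha>"
    using assms(2) by (simp add: cball_scale)
  then have "{l. 0 \<le> l \<and> l *\<^sub>R \<theta> \<in> (\<lambda>y. \<alpha> *\<^sub>R y) ` cball 0 1} = {0..\<alpha>}"
    using assms(1) by auto
  moreover have "(SUP l\<in>{0..\<alpha>}. ennreal l) = ennreal \<alpha>"
    using assms(2) by (intro antisym SUP_least SUP_upper) (auto intro: ennreal_leI)
  ultimately show ?thesis
    unfolding radial_function_def by simp
qed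

text \<open>By \<open>star_body_radial_ex1\<close> the definite description denotes a star body with
  the prescribed radial function, so membership on a ray is a comparison with that function.\<close>

lemma mem_radial_sum_iff:
  fixes \<theta> :: "'a::euclidean_space"
  assumes "norm \<theta> = 1" "0 \<le> r"
  shows "r *\<^sub>R \<theta> \<in> radial_sum A B \<longleftrightarrow> ennreal r \<le> radial_function A \<theta> + radial_function B \<theta>"
proof -
  have "star_body (radial_sum A B) \<and>
    (\<forall>\<theta>\<in>sphere 0 1. radial_function (radial_sum A B) \<theta> = radial_function A \<theta> + radial_function B \<theta>)"
    unfolding radial_sum_def by (rule theI') (rule star_body_radial_ex1)
  then show ?thesis
    using mem_star_body_iff[of "radial_sum A B" \<theta> r] assms by simp
qed

text \<open>Along the ray, membership turns the infimum into one over all \<alpha> > 0 with r \<le>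
  \<rho> + \<alpha>. Subtraction in \<open>ennreal\<close> truncates at 0, which supplies the
  positive part and also the value 0 for infinite \<rho>.\<close>

lemma radial_dist_scaleR:
  fixes \<theta> :: "'a::euclidean_space"
  assumes "norm \<theta> = 1" "0 \<le> r"
  shows "radial_dist (r *\<^sub>R \<theta>) A = enn2real (ennreal r - radial_function A \<theta>)"
proof -
  have "radial_dist (r *\<^sub>R \<theta>) A = Inf {\<alpha>. 0 < \<alpha> \<and> ennreal r \<le> radial_function A \<theta> + ennreal \<alpha>}"
    unfolding radial_dist_def
    by (intro arg_cong[where f = Inf] Collect_cong)
      (auto simp: mem_radial_sum_iff[OF assms] radial_function_cball[OF assms(1)])
  also have "\<dots> = enn2real (ennreal r - radial_function A \<theta>)"
  proof (cases "radial_function A \<theta>")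
    case (real s)
    have "ennreal r \<le> ennreal s + ennreal \<alpha> \<longleftrightarrow> r - s \<le> \<alpha>" if "0 < \<alpha>" for \<alpha>
    proof -
      have "ennreal r \<le> ennreal (s + \<alpha>) \<longleftrightarrow> r - s \<le> \<alpha>"
        using that real by (subst ennreal_le_iff) auto
      then show ?thesis
        using that real by simp
    qed
    then have eq: "{\<alpha>. 0 < \<alpha> \<and> ennreal r \<le> radial_function A \<theta> + ennreal \<alpha>} =
        {\<alpha>. 0 < \<alpha> \<and> r - s \<le> \<alpha>}"
      using real by auto
    have diff: "ennreal r - radial_function A \<theta> = ennreal (r - s)"
      using real by (simp add: ennreal_minus)
    show ?thesis
    proof (cases "r \<le> s")
      case True
      \<comment> \<open>The value \<alpha> = 0 is excluded, so the infimum 0 is not attained in this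
        case.\<close>
      then have "{\<alpha>. 0 < \<alpha> \<and> r - s \<le> \<alpha>} = {0<..}" by auto
      then show ?thesis using eq diff True by (simp add: ennreal_neg)
    next
      case False
      then have "{\<alpha>. 0 < \<alpha> \<and> r - s \<le> \<alpha>} = {r - s..}" by auto
      then show ?thesis using eq diff False by simp
    qed
  next
    case top
    then have "{\<alpha>. 0 < \<alpha> \<and> ennreal r \<le> radial_function A \<theta> + ennreal \<alpha>} = {0<..}" by auto
    then show ?thesis using top by (simp add: ennreal_minus_eq_0)
  qed
  finally show ?thesis .
qed

lemma tendsto_enn2real_diff_iff:
  fixes f :: "'b \<Rightarrow> ennreal"
  shows "(\<forall>r\<ge>0. ((\<lambda>i. enn2real (ennreal r - f i)) \<longlongrightarrow> enn2real (ennreal r - p)) F) \<longleftrightarrow>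
    (f \<longlongrightarrow> p) F"
proof -
  \<comment> \<open>The difference is at most \<open>ennreal r\<close>, hence finite, and
    \<open>enn2real\<close> loses no information.\<close>
  have fin: "ennreal (enn2real (ennreal r - q)) = ennreal r - q" for r q
    by (intro ennreal_enn2real) (simp add: less_top[symmetric] ennreal_minus_eq_top)
  show ?thesis
  proof (intro iffI allI impI)
    fix r :: real
    assume "(f \<longlongrightarrow> p) F"
    have "((\<lambda>i. ennreal r - f i) \<longlongrightarrow> ennreal r - p) F"
    \<comment> \<open>Continuity of subtraction is available at finite limits; for an infinite limit
      the differences are eventually 0.\<close>
    proof (cases "p = top")
      case True
      with \<open>(f \<longlongrightarrow> p) F\<close> have "\<forall>\<^sub>F i in F. ennreal r < f i"
        by (intro order_tendstoD(1)) auto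
      then have "\<forall>\<^sub>F i in F. ennreal r - f i = 0"
        by eventually_elim (auto intro: diff_eq_0_ennreal)
      with True show ?thesis
        by (simp add: tendsto_eventually)
    next
      case False
      with \<open>(f \<longlongrightarrow> p) F\<close> show ?thesis
        by (intro tendsto_diff_ennreal tendsto_const) auto
    qed
    then show "((\<lambda>i. enn2real (ennreal r - f i)) \<longlongrightarrow> enn2real (ennreal r - p)) F"
      by (intro tendsto_enn2real) (simp_all add: fin)
  next
    assume lim: "\<forall>r\<ge>0. ((\<lambda>i. enn2real (ennreal r - f i)) \<longlongrightarrow> enn2real (ennreal r - p)) F"
    have conv: "((\<lambda>i. ennreal r - f i) \<longlongrightarrow> ennreal r - p) F" if "0 \<le> r" for r
      using tendsto_ennrealI[OF lim[rule_format, OF that]] unfolding fin .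
    show "(f \<longlongrightarrow> p) F"
    proof (rule order_tendstoI)
      fix a assume "a < p"
      \<comment> \<open>Lying strictly below \<open>p\<close>, the level \<open>b\<close> is a real
        number even if \<open>p\<close> is infinite.\<close>
      then obtain b where b: "a < b" "b < p" using dense by blast
      then obtain r where r: "0 \<le> r" "b = ennreal r" by (cases b) auto
      \<comment> \<open>The left side is 0 because b < p, and the right side is positive because a <
        b.\<close>
      have "ennreal r - p < b - a"
        using b r by (simp add: diff_eq_0_ennreal diff_gr0_ennreal less_imp_le)
      then have "\<forall>\<^sub>F i in F. b - f i < b - a"
        using order_tendstoD(2)[OF conv[OF r(1)]] r by simp
      then show "\<forall>\<^sub>F i in F. a < f i"
      proof eventually_elim
        case (elim i)
        show ?case
        proof (rule ccontr)
          \<comment> \<open>Truncated subtraction is antitone in its second argument, so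
            \<open>f i\<close> \<le> a would keep the difference at least b - a.\<close>
          assume "\<not> a < f i"
          then have "b - a \<le> b - f i"
            by (intro ennreal_minus_mono) auto
          with elim show False by simp
        qed
      qed
    next
      fix a assume "p < a"
      \<comment> \<open>The intermediate level is again real, even if \<open>a\<close> is
        infinite.\<close>
      then obtain b where b: "p < b" "b < a" using dense by blast
      then obtain r where r: "0 \<le> r" "b = ennreal r" by (cases b) auto
      have "0 < b - p"
        using b r by (simp add: diff_gr0_ennreal)
      then have "\<forall>\<^sub>F i in F. 0 < b - f i"
        using order_tendstoD(1)[OF conv[OF r(1)]] r by simp
      then show "\<forall>\<^sub>F i in F. f i < a"
      proof eventually_elim
        case (elim i)
        have "f i < b"
        proof (rule ccontr)
          assume "\<not> f i < b"
          then have "b - f i = 0"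
            using r by (intro diff_eq_0_ennreal) auto
          with elim show False by simp
        qed
        with b(2) show ?case by simp
      qed
    qed
  qed
qed

text \<open>Testing a sub-basis suffices: holding eventually is stable under finite intersections,
  and for a union one member containing \<open>x\<close> is enough.\<close>

lemma limitin_topology_generated_by:
  assumes "x \<in> topspace (topology_generated_by B)"
    and "\<And>U. U \<in> B \<Longrightarrow> x \<in> U \<Longrightarrow> \<forall>\<^sub>F i in F. f i \<in> U"
  shows "limitin (topology_generated_by B) f x F"
proof -
  have "\<forall>\<^sub>F i in F. f i \<in> V" if "generate_topology_on B V" "x \<in> V" for V
    using that
  proof (induction rule: generate_topology_on.induct)
    case Empty
    then show ?case by simp
  next
    case (Int a b)
    then show ?case by (simp add: eventually_conj_iff)
  next
    case (UN K)
    then obtain k where "k \<in> K" "x \<in> k" by blast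
    with UN show ?case by (fast elim: eventually_mono)
  next
    case (Basis s)
    then show ?case using assms(2) by blast
  qed
  then show ?thesis
    using assms(1) by (auto simp: limitin_def openin_topology_generated_by_iff)
qed

lemma limitin_radial_wijsman_iff:
  assumes "A \<in> S" and "\<forall>\<^sub>F i in F. As i \<in> S"
  shows "limitin (radial_wijsman S) As A F \<longleftrightarrow>
    (\<forall>x. ((\<lambda>i. radial_dist x (As i)) \<longlongrightarrow> radial_dist x A) F)"
proof (intro iffI allI)
  fix x
  assume "limitin (radial_wijsman S) As A F"
  from continuous_map_limit[OF continuous_map_radial_dist this, of x]
  show "((\<lambda>i. radial_dist x (As i)) \<longlongrightarrow> radial_dist x A) F"
    by (simp add: o_def)
next
  assume lim: "\<forall>x. ((\<lambda>i. radial_dist x (As i)) \<longlongrightarrow> radial_dist x A) F"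
  show "limitin (radial_wijsman S) As A F"
    unfolding radial_wijsman_def
  proof (rule limitin_topology_generated_by)
    show "A \<in> topspace (topology_generated_by {{A \<in> S. radial_dist x A \<in> U} |x U. open U})"
      using assms(1) by (simp flip: radial_wijsman_def)
  next
    fix V
    assume V: "V \<in> {{A \<in> S. radial_dist x A \<in> U} |x U. open U}" "A \<in> V"
    then obtain x U where xU: "V = {A \<in> S. radial_dist x A \<in> U}" "open U" by blast
    have "\<forall>\<^sub>F i in F. radial_dist x (As i) \<in> U"
      using lim V(2) xU by (auto intro: topological_tendstoD)
    with assms(2) show "\<forall>\<^sub>F i in F. As i \<in> V"
      unfolding xU(1) by eventually_elim simp
  qed
qed

text \<open>Leaving \<open>S\<close> arbitrary lets one argument serve both families. Polar
  coordinates split the condition over all points into one condition per direction.\<close>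

lemma limitin_radial_wijsman_iff_radial_function:
  fixes A :: "'a::euclidean_space set"
  assumes "A \<in> S" and "\<forall>\<^sub>F i in F. As i \<in> S"
  shows "limitin (radial_wijsman S) As A F \<longleftrightarrow>
    (\<forall>\<theta>\<in>sphere 0 1. ((\<lambda>i. radial_function (As i) \<theta>) \<longlongrightarrow> radial_function A \<theta>) F)"
proof -
  have polar: "\<exists>r\<ge>0. \<exists>\<theta>\<in>sphere 0 1. x = r *\<^sub>R \<theta>" for x :: 'a
  proof (cases "x = 0")
    case True
    \<comment> \<open>The origin has no direction of its own; any unit vector serves, with r =
      0.\<close>
    obtain b :: 'a where "norm b = 1" using vector_choose_size[of 1] by auto
    then show ?thesis using True by (intro exI[of _ 0]) auto
  next
    case False
    then show ?thesis
      by (intro exI[of _ "norm x"] conjI bexI[of _ "x /\<^sub>R norm x"]) auto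
  qed
  have "limitin (radial_wijsman S) As A F \<longleftrightarrow>
      (\<forall>x. ((\<lambda>i. radial_dist x (As i)) \<longlongrightarrow> radial_dist x A) F)"
    by (rule limitin_radial_wijsman_iff[OF assms])
  also have "\<dots> \<longleftrightarrow> (\<forall>\<theta>\<in>sphere 0 1. \<forall>r\<ge>0.
      ((\<lambda>i. radial_dist (r *\<^sub>R \<theta>) (As i)) \<longlongrightarrow> radial_dist (r *\<^sub>R \<theta>) A) F)"
  proof (intro iffI ballI allI impI)
    fix x :: 'a
    assume *: "\<forall>\<theta>\<in>sphere 0 1. \<forall>r\<ge>0.
      ((\<lambda>i. radial_dist (r *\<^sub>R \<theta>) (As i)) \<longlongrightarrow> radial_dist (r *\<^sub>R \<theta>) A) F"
    obtain r \<theta> where "0 \<le> r" "\<theta> \<in> sphere 0 1" "x = r *\<^sub>R \<theta>"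
      using polar by blast
    with * show "((\<lambda>i. radial_dist x (As i)) \<longlongrightarrow> radial_dist x A) F"
      by blast
  qed blast
  also have "\<dots> \<longleftrightarrow>
      (\<forall>\<theta>\<in>sphere 0 1. ((\<lambda>i. radial_function (As i) \<theta>) \<longlongrightarrow> radial_function A \<theta>) F)"
    by (intro ball_cong refl, subst tendsto_enn2real_diff_iff[symmetric])
      (simp add: radial_dist_scaleR)
  finally show ?thesis .
qed

theorem theorem3p2:
  fixes I :: "'i set" and le :: "'i \<Rightarrow> 'i \<Rightarrow> bool"
    and As :: "'i \<Rightarrow> (real ^ 'n) set" and A :: "(real ^ 'n) set"
  assumes "CARD('n) \<ge> 2"
    and "directed_set I le"
  shows "((\<forall>i\<in>I. As i \<in> star_bodies) \<and> A \<in> star_bodies \<longrightarrow>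
            (limitin (radial_wijsman star_bodies) As A (net_filter I le) \<longleftrightarrow>
             (\<forall>\<theta>\<in>sphere 0 1. ((\<lambda>i. radial_function (As i) \<theta>) \<longlongrightarrow> radial_function A \<theta>)
                (net_filter I le)))) \<and>
         ((\<forall>i\<in>I. As i \<in> continuous_star_bodies) \<and> A \<in> continuous_star_bodies \<longrightarrow>
            (limitin (radial_wijsman continuous_star_bodies) As A (net_filter I le) \<longleftrightarrow>
             (\<forall>\<theta>\<in>sphere 0 1. ((\<lambda>i. radial_function (As i) \<theta>) \<longlongrightarrow> radial_function A \<theta>)
                (net_filter I le))))"
proof -
  have ev: "\<forall>\<^sub>F i in net_filter I le. As i \<in> S" if "\<forall>i\<in>I. As i \<in> S" for S
  proof -
    \<comment> \<open>Any index starts a tail, and every tail stays inside \<open>I\<close>.\<close>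
    have "I \<noteq> {}"
      using assms(2) by (simp add: directed_set_def)
    then show ?thesis
      using that unfolding eventually_net_filter[OF assms(2)] by blast
  qed
  show ?thesis
    by (intro conjI impI limitin_radial_wijsman_iff_radial_function ev) auto
qed

end
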